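(* Let $H$ be a hypergraph. Two disjoint subsets $U=\{u_1,u_2,\ldots,u_p\}$ and $V=\{v_1,v_2,\ldots,v_q\}$ of the vertex set $V(H)$ form an equal partition of hyperedges in $H$ if and only if $A_{G_H}\tilde x=0$, where $x=\chi_U-\chi_V$.
   Context: A hypergraph $H=(V(H),E(H))$ consists of a finite non-empty vertex set $V(H)$ and a set $E(H)\subseteq\mathcal{P}(V(H))$ of hyperedges. Two disjoint subsets $U,V\subseteq V(H)$ form an equal partition of hyperedges in $H$ if $|U\cap e|=|V\cap e|$ for all $e\in E(H)$. The incidence matrix $I_H=[i_{ve}]_{v\in V(H),e\in E(H)}$ has $i_{ve}=1$ if $v\in e$ and $0$ otherwise. The incidence graph $G_H$ is the bipartite graph on the disjoint union $V(G_H)=V(H)\sqcup E(H)$ in which $v\in V(H)$ and $e\in E(H)$ are adjacent iff $v\in e$; its adjacency matrix is $A_{G_H}=\begin{bmatrix}0&I_H\\ I_H^T&0\end{bmatrix}$. For $U\subseteq V(H)$, $\chi_U:V(H)\to\mathbb{R}$ is its characteristic function. For $x:V(H)\to\mathbb{R}$, $\tilde x:V(G_H)\to\mathbb{R}$ is its extension by zero on $E(H)$. *)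

theory Defs
  imports Complex_Main "HOL-Library.Indicator_Function" "Graph_Theory.Pair_Digraph"
begin

record 'a hypergraph =
  hverts :: "'a set"
  hedges :: "'a set set"

locale hypergraph =
  fixes H :: "'a hypergraph"
  assumes finite_hverts: "finite (hverts H)"
    and hverts_nonempty: "hverts H \<noteq> {}"
    and hedges_subset: "hedges H \<subseteq> Pow (hverts H)"

definition equal_partition_of_hyperedges :: "'a hypergraph \<Rightarrow> 'a set \<Rightarrow> 'a set \<Rightarrow> bool" where
  "equal_partition_of_hyperedges H U V \<longleftrightarrow>
     U \<subseteq> hverts H \<and> V \<subseteq> hverts H \<and> U \<inter> V = {} \<and>
     (\<forall>e\<in>hedges H. card (U \<inter> e) = card (V \<inter> e))"

text \<open>
  Matrices and vectors are indexed by the (unordered) vertex and hyperedge sets themselves: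
  they are real functions, of which only the values on the relevant finite index sets matter.
\<close>

definition incidence_matrix :: "'a hypergraph \<Rightarrow> 'a \<Rightarrow> 'a set \<Rightarrow> real" where
  "incidence_matrix H v e = (if v \<in> hverts H \<and> e \<in> hedges H \<and> v \<in> e then 1 else 0)"

text \<open>
  An undirected graph is a symmetric digraph, as usual in the Graph Theory library; the disjoint
  union of vertices and hyperedges is tagged by \<open>Inl\<close> and \<open>Inr\<close>.
\<close>

definition incidence_graph :: "'a hypergraph \<Rightarrow> ('a + 'a set) pair_pre_digraph" where
  "incidence_graph H =
     \<lparr> pverts = hverts H <+> hedges H,
       parcs = {(Inl v, Inr e) | v e. v \<in> hverts H \<and> e \<in> hedges H \<and> v \<in> e}
             \<union> {(Inr e, Inl v) | v e. v \<in> hverts H \<and> e \<in> hedges H \<and> v \<in> e} \<rparr>"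

definition adjacency_matrix :: "'b pair_pre_digraph \<Rightarrow> 'b \<Rightarrow> 'b \<Rightarrow> real" where
  "adjacency_matrix G u w = (if (u, w) \<in> parcs G then 1 else 0)"

definition mat_vec :: "'b set \<Rightarrow> ('b \<Rightarrow> 'b \<Rightarrow> real) \<Rightarrow> ('b \<Rightarrow> real) \<Rightarrow> 'b \<Rightarrow> real" where
  "mat_vec S A x i = (\<Sum>j\<in>S. A i j * x j)"

definition zero_extension :: "('a \<Rightarrow> real) \<Rightarrow> 'a + 'a set \<Rightarrow> real" where
  "zero_extension x = case_sum x (\<lambda>e. 0)"

lemma (in hypergraph) finite_hedges: "finite (hedges H)"
  using finite_hverts hedges_subset by (meson finite_Pow_iff finite_subset)

lemma (in hypergraph) pair_graph_incidence_graph: "pair_graph (incidence_graph H)"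
  by unfold_locales
    (auto simp: incidence_graph_def finite_hverts finite_hedges sym_def symmetric_def
       arcs_ends_conv
       intro: finite_subset[of _ "(hverts H <+> hedges H) \<times> (hverts H <+> hedges H)"])

lemma adjacency_matrix_incidence_graph_block:
  "adjacency_matrix (incidence_graph H) (Inl v) (Inl v') = 0"
  "adjacency_matrix (incidence_graph H) (Inl v) (Inr e) = incidence_matrix H v e"
  "adjacency_matrix (incidence_graph H) (Inr e) (Inl v) = incidence_matrix H v e"
  "adjacency_matrix (incidence_graph H) (Inr e) (Inr e') = 0"
  by (auto simp: adjacency_matrix_def incidence_graph_def incidence_matrix_def)

end

theory Submission
  imports Defs
begin

text \<open>
  The vector \<open>\<chi>\<^sub>U - \<chi>\<^sub>V\<close> is supported on the vertex side of the bipartite incidence graph, and the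
  adjacency matrix only links the two sides. Hence its image vanishes on the vertex side for free,
  whereas its entry at a hyperedge \<open>e\<close> is the sum of \<open>\<chi>\<^sub>U - \<chi>\<^sub>V\<close> over \<open>e\<close>, which is
  \<open>\<bar>U \<inter> e\<bar> - \<bar>V \<inter> e\<bar>\<close>. All entries are zero exactly when \<open>U\<close> and \<open>V\<close> meet every hyperedge in equally
  many vertices. The two entry computations are \<open>mat_vec_zero_extension_Inl\<close> and
  \<open>mat_vec_zero_extension_Inr\<close>.
\<close>

context hypergraph
begin

lemma sum_pverts_incidence_graph:
  fixes f :: "'a + 'a set \<Rightarrow> real"
  shows "(\<Sum>w\<in>pverts (incidence_graph H). f w) =
    (\<Sum>v\<in>hverts H. f (Inl v)) + (\<Sum>e\<in>hedges H. f (Inr e))"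
  by (simp add: incidence_graph_def sum.Plus finite_hverts finite_hedges)

text \<open>
  A vertex is adjacent to hyperedges only, and there the extended vector is zero.
\<close>

lemma mat_vec_zero_extension_Inl:
  "mat_vec (pverts (incidence_graph H)) (adjacency_matrix (incidence_graph H))
     (zero_extension x) (Inl v) = 0"
  by (simp add: mat_vec_def sum_pverts_incidence_graph adjacency_matrix_incidence_graph_block
      zero_extension_def)

text \<open>
  The row of a hyperedge selects its vertices; all of them belong to the vertex set, so none of the
  summands is lost.
\<close>

lemma mat_vec_zero_extension_Inr:
  assumes "e \<in> hedges H"
  shows "mat_vec (pverts (incidence_graph H)) (adjacency_matrix (incidence_graph H))
     (zero_extension x) (Inr e) = (\<Sum>v\<in>e. x v)"
proof -
  have e: "e \<subseteq> hverts H"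
    using assms hedges_subset by auto
  have "mat_vec (pverts (incidence_graph H)) (adjacency_matrix (incidence_graph H))
     (zero_extension x) (Inr e) = (\<Sum>v\<in>hverts H. incidence_matrix H v e * x v)"
    by (simp add: mat_vec_def sum_pverts_incidence_graph adjacency_matrix_incidence_graph_block
        zero_extension_def)
  also have "\<dots> = (\<Sum>v\<in>e. x v)"
    using e assms
    by (intro sum.mono_neutral_cong_right) (auto simp: finite_hverts incidence_matrix_def)
  finally show ?thesis .
qed

end

lemma sum_indicator_diff_eq_0_iff:
  assumes "finite e"
  shows "(\<Sum>v\<in>e. indicat_real U v - indicat_real V v) = 0 \<longleftrightarrow> card (U \<inter> e) = card (V \<inter> e)"
proof -
  have "sum (indicat_real W) e = real (card (W \<inter> e))" for W
    using assms by (simp add: indicator_def sum.If_cases Int_commute)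
  then show ?thesis
    by (simp add: sum_subtractf)
qed

theorem theorem2p19:
  fixes H :: "'a hypergraph" and U V :: "'a set" and x :: "'a \<Rightarrow> real"
  assumes "hypergraph H"
    and "U \<subseteq> hverts H" and "V \<subseteq> hverts H" and "U \<inter> V = {}"
    and "x = (\<lambda>v. indicat_real U v - indicat_real V v)"
  shows "equal_partition_of_hyperedges H U V \<longleftrightarrow>
    (\<forall>w\<in>pverts (incidence_graph H).
       mat_vec (pverts (incidence_graph H)) (adjacency_matrix (incidence_graph H))
         (zero_extension x) w = 0)"
proof -
  interpret hypergraph H by fact
  let ?y = "mat_vec (pverts (incidence_graph H)) (adjacency_matrix (incidence_graph H))
    (zero_extension x)"
  have entry: "?y (Inr e) = 0 \<longleftrightarrow> card (U \<inter> e) = card (V \<inter> e)" if "e \<in> hedges H" for e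
  proof -
    have "finite e"
      using that hedges_subset finite_hverts by (auto intro: finite_subset)
    then show ?thesis
      using that by (simp add: mat_vec_zero_extension_Inr assms(5) sum_indicator_diff_eq_0_iff)
  qed
  have "(\<forall>w\<in>pverts (incidence_graph H). ?y w = 0) \<longleftrightarrow>
      (\<forall>v\<in>hverts H. ?y (Inl v) = 0) \<and> (\<forall>e\<in>hedges H. ?y (Inr e) = 0)"
    by (auto simp: incidence_graph_def)
  also have "\<dots> \<longleftrightarrow> (\<forall>e\<in>hedges H. card (U \<inter> e) = card (V \<inter> e))"
    by (simp add: mat_vec_zero_extension_Inl entry)
  also have "\<dots> \<longleftrightarrow> equal_partition_of_hyperedges H U V"
    using assms(2-4) by (simp add: equal_partition_of_hyperedges_def)
  finally show ?thesis by simp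
qed

end
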